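(* There exist universal constants $c_1,c_2>0$ such that for every $n\ge1$, every $t\in\mathbb{R}$ and every $a\in\mathbb{R}^n$ with $a_1\ge a_2\ge\dots\ge a_n\ge0$ and $\sum_i a_i^2=1$, the halfspace $f:\{-1,1\}^n\to\{0,1\}$, $f(x)=\mathbf{1}\left(\sum_i a_ix_i>t\right)$, satisfies: if $\mathbb{E}[f]\le\frac12$, then $$c_1\,\mathbb{E}[f]\min\left\{1,a_1\sqrt{\log(1/\mathbb{E}[f])}\right\}\;\le\;\max_i I_i(f)\;\le\; c_2\,\mathbb{E}[f]\min\left\{1,a_1\sqrt{\log(1/\mathbb{E}[f])}\right\}.$$
   Context: Expectations and probabilities are with respect to the uniform measure on $\{-1,1\}^n$. The influence of coordinate $i$ on $f$ is $I_i(f)=\Pr_x[f(x)\ne f(x\oplus e_i)]$, where $x\oplus e_i$ is $x$ with the $i$th coordinate flipped. $\log$ is the natural logarithm. If $\mathbb{E}[f]=0$, both bounding expressions are interpreted as $0$. *)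

theory Defs
  imports "HOL-Probability.Probability"
begin

(* Points of the cube are extensional functions on {1..n}, so that the dimension n can be
   quantified inside a formula; coordinates are numbered from 1. *)
definition cube :: "nat \<Rightarrow> (nat \<Rightarrow> real) set" where
  "cube n = {1..n} \<rightarrow>\<^sub>E {-1, 1}"

lemma finite_cube: "finite (cube n)"
  by (simp add: cube_def finite_PiE)

(* Without finiteness and nonemptiness pmf_of_set (cube n) would be unspecified. *)
lemma cube_nonempty: "cube n \<noteq> {}"
  by (simp add: cube_def PiE_eq_empty_iff)

definition cube_pmf :: "nat \<Rightarrow> (nat \<Rightarrow> real) pmf" where
  "cube_pmf n = pmf_of_set (cube n)"

definition flip :: "(nat \<Rightarrow> real) \<Rightarrow> nat \<Rightarrow> nat \<Rightarrow> real" where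
  "flip x i = x(i := - x i)"

definition influence :: "nat \<Rightarrow> ((nat \<Rightarrow> real) \<Rightarrow> real) \<Rightarrow> nat \<Rightarrow> real" where
  "influence n f i = measure_pmf.prob (cube_pmf n) {x. f x \<noteq> f (flip x i)}"

definition halfspace :: "nat \<Rightarrow> (nat \<Rightarrow> real) \<Rightarrow> real \<Rightarrow> (nat \<Rightarrow> real) \<Rightarrow> real" where
  "halfspace n a t x = of_bool ((\<Sum>i=1..n. a i * x i) > t)"

(* The common shape of the two bounds, for mean m and largest weight b; the case m = 0 is the
   convention that the expression is then 0. *)
definition influence_bound :: "real \<Rightarrow> real \<Rightarrow> real" where
  "influence_bound m b = (if m = 0 then 0 else m * min 1 (b * sqrt (ln (1 / m))))"

end

theory Submission
  imports Defs
begin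

text \<open>
Let \<open>X\<close> be the weighted sum of the signs, \<open>Y\<close> the sum without the first coordinate,
\<open>a\<close> the largest weight, \<open>m = P(X > t)\<close> and \<open>L = ln (1 / m)\<close>. Since \<open>X\<close> is symmetric
and \<open>m \<le> 1 / 2\<close>, one may take \<open>t \<ge> 0\<close> (\<open>negative_threshold\<close>). The first influence is
the probability that \<open>Y\<close> lies in the window \<open>(t - a, t + a]\<close>, and every influence is at most
\<open>2 * P(t < X \<le> t + 2 * a)\<close>, in particular at most \<open>2 * m\<close>.

Upper bound. Let \<open>G\<close> be the ramp that grows with slope 1 from 0 at \<open>t\<close> to \<open>4 * a\<close>.
Integration by parts on the cube (\<open>ramp_moment_ge\<close>) bounds \<open>E[G(X) X]\<close> from below by the
expectation, over the event \<open>t < X \<le> t + 2 * a\<close>, of twice the total squared weight of the negative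
signs. This weight is at least 1/8 except on an event whose probability is negligible when
\<open>a * sqrt L\<close> is small. From above, \<open>E[G(X) X]\<close> is at most
\<open>4 * a * E[X; X > t]\<close>, and the level-1 inequality (\<open>first_moment_above_le\<close>) bounds this by
\<open>4 * a * m * sqrt (2 * L)\<close>. The combination is \<open>rad_prob_window_le\<close>.

Lower bound. The logarithmic Sobolev inequality shows that a constant fraction of the tail
\<open>X > t\<close> lies within distance \<open>d\<close> of order \<open>1 / sqrt L\<close> from \<open>t\<close>
(\<open>local_Chernoff\<close>). If \<open>d \<le> 2 * a\<close>, the influence of the first coordinate is at least
\<open>m\<close>. Otherwise this mass is spread over about \<open>d / a\<close> windows of width \<open>2 * a\<close>, and it
remains to see that none of them is much heavier than the window at \<open>t\<close>
(\<open>window_le_window\<close>). The reflection principle for the walk \<open>Y\<close> proves this up to an overshoot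
of one window width. To gain the last width (\<open>halfstep_shift\<close>), weights below \<open>a / 2\<close> are again
handled by reflection, now with half the overshoot. For weights of at least \<open>a / 2\<close> a symmetric
chain decomposition is used, whose chains cannot jump over an interval of length \<open>2 * a\<close> and
meet an interval of length \<open>a / 2\<close> at most once.
\<close>

section \<open>Expectations over random signs\<close>

text \<open>\<open>rad_exp bs F\<close> is the expectation of \<open>F (\<Sum>j. b\<^sub>j x\<^sub>j)\<close> for independent uniform signs
\<open>x\<^sub>j\<close> and \<open>bs = [b\<^sub>1, b\<^sub>2, \<dots>]\<close>. Averaging over one sign at a time turns tail estimates into
inductions on the list of weights. The values are vectors because the upper bound needs
the joint law of \<open>\<Sum>j. b\<^sub>j x\<^sub>j\<close> and \<open>\<Sum>j. b\<^sub>j\<^sup>2 x\<^sub>j\<close>.\<close>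

primrec rad_exp :: "'v::ab_group_add list \<Rightarrow> ('v \<Rightarrow> real) \<Rightarrow> real" where
  "rad_exp [] F = F 0"
| "rad_exp (b # bs) F = (rad_exp bs (\<lambda>s. F (s + b)) + rad_exp bs (\<lambda>s. F (s - b))) / 2"

abbreviation rad_prob :: "'v::ab_group_add list \<Rightarrow> 'v set \<Rightarrow> real" where
  "rad_prob bs A \<equiv> rad_exp bs (indicat_real A)"

lemma rad_exp_const [simp]: "rad_exp bs (\<lambda>_. c) = c"
  by (induction bs) auto

lemma rad_exp_add: "rad_exp bs (\<lambda>s. F s + G s) = rad_exp bs F + rad_exp bs G"
  by (induction bs arbitrary: F G) (auto simp: field_simps)

lemma rad_exp_cmult: "rad_exp bs (\<lambda>s. c * F s) = c * rad_exp bs F"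
  by (induction bs arbitrary: F) (auto simp: field_simps)

lemma rad_exp_diff: "rad_exp bs (\<lambda>s. F s - G s) = rad_exp bs F - rad_exp bs G"
  using rad_exp_add[of bs F "\<lambda>s. (-1) * G s"] rad_exp_cmult[of bs "-1" G] by simp

lemma rad_exp_mono: "(\<And>s. F s \<le> G s) \<Longrightarrow> rad_exp bs F \<le> rad_exp bs G"
  by (induction bs arbitrary: F G) (auto intro!: divide_right_mono add_mono)

lemma rad_exp_nonneg: "(\<And>s. 0 \<le> F s) \<Longrightarrow> 0 \<le> rad_exp bs F"
  using rad_exp_mono[of "\<lambda>_. 0" F bs] by simp

lemma rad_exp_sum: "rad_exp bs (\<lambda>s. \<Sum>j\<in>J. F j s) = (\<Sum>j\<in>J. rad_exp bs (F j))"
  by (induction J rule: infinite_finite_induct) (auto simp: rad_exp_add)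

lemma rad_prob_mono: "A \<subseteq> B \<Longrightarrow> rad_prob bs A \<le> rad_prob bs B"
  by (intro rad_exp_mono) (auto simp: indicator_def)

lemma rad_prob_nonneg: "0 \<le> rad_prob bs A"
  by (intro rad_exp_nonneg) auto

lemma rad_prob_split:
  assumes "C = A \<union> B" "A \<inter> B = {}"
  shows "rad_prob bs C = rad_prob bs A + rad_prob bs B"
  unfolding rad_exp_add[symmetric]
  using assms by (intro arg_cong[where f = "rad_exp bs"] ext) (auto simp: indicator_def)

lemma rad_prob_union_le: "rad_prob bs (A \<union> B) \<le> rad_prob bs A + rad_prob bs B"
  unfolding rad_exp_add[symmetric] by (intro rad_exp_mono) (auto simp: indicator_def)

lemma rad_exp_uminus: "rad_exp bs (\<lambda>s. F (- s)) = rad_exp bs F"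
proof (induction bs arbitrary: F)
  case (Cons b bs)
  have "rad_exp bs (\<lambda>s. F (- (s + b))) = rad_exp bs (\<lambda>s. F (s - b))"
    using Cons[of "\<lambda>s. F (s - b)"] by simp
  moreover have "rad_exp bs (\<lambda>s. F (- (s - b))) = rad_exp bs (\<lambda>s. F (s + b))"
    using Cons[of "\<lambda>s. F (s + b)"] by (simp add: algebra_simps)
  ultimately show ?case by simp
qed simp

lemma rad_exp_append: "rad_exp (xs @ ys) F = rad_exp xs (\<lambda>u. rad_exp ys (\<lambda>v. F (u + v)))"
proof (induction xs arbitrary: F)
  case (Cons b xs)
  have "(\<lambda>u. rad_exp ys (\<lambda>v. F (u + v + b))) = (\<lambda>u. rad_exp ys (\<lambda>v. F (u + b + v)))"
       "(\<lambda>u. rad_exp ys (\<lambda>v. F (u + v - b))) = (\<lambda>u. rad_exp ys (\<lambda>v. F (u - b + v)))"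
    by (simp_all add: algebra_simps)
  then show ?case using Cons by simp
qed simp

lemma rad_exp_swap:
  "rad_exp xs (\<lambda>u. rad_exp ys (\<lambda>v. H u v)) = rad_exp ys (\<lambda>v. rad_exp xs (\<lambda>u. H u v))"
proof (induction xs arbitrary: H)
  case (Cons b xs)
  have "rad_exp ys (\<lambda>v. P v / 2) = rad_exp ys P / 2" for P
    using rad_exp_cmult[of ys "1/2" P] by simp
  then show ?case using Cons by (simp add: rad_exp_add)
qed simp

lemma rad_exp_map:
  assumes "h 0 = 0" "\<And>x y. h (x + y) = h x + h y" "\<And>x y. h (x - y) = h x - h y"
  shows "rad_exp (map h bs) F = rad_exp bs (\<lambda>s. F (h s))"
  by (induction bs arbitrary: F) (auto simp: assms)

section \<open>Reflection of a walk\<close>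

text \<open>The reflection principle. A walk started at \<open>x \<le> r\<close> that ends in \<open>{c<..d}\<close>, above \<open>r\<close>, has a
first position \<open>z > r\<close>; it overshoots \<open>r\<close> by at most one step, so \<open>z \<le> r + b\<close>. The
remaining steps are symmetric, and negating them carries the endpoint \<open>e\<close> to
\<open>2 * z - e\<close>. In the induction the negation happens as soon as the next step passes \<open>r\<close>; until
then the hypothesis is applied to both successors.\<close>

lemma reflection_from:
  fixes x :: real
  assumes "\<And>y. y \<in> set bs \<Longrightarrow> 0 \<le> y \<and> y \<le> b" "x \<le> r" "r \<le> c"
  shows "rad_exp bs (\<lambda>s. indicat_real {c<..d} (x + s))
       \<le> rad_exp bs (\<lambda>s. indicat_real {2*r - d<..<2*r - c + 2*b} (x + s))"
  using assms
proof (induction bs arbitrary: x)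
  case (Cons y bs)
  have y: "0 \<le> y" "y \<le> b" using Cons.prems(1)[of y] by auto
  have down: "rad_exp bs (\<lambda>s. indicat_real {c<..d} (x - y + s))
       \<le> rad_exp bs (\<lambda>s. indicat_real {2*r - d<..<2*r - c + 2*b} (x - y + s))"
  proof (rule Cons.IH)
    show "x - y \<le> r" using Cons.prems(2) y by linarith
  qed (use Cons.prems in auto)
  have up: "rad_exp bs (\<lambda>s. indicat_real {c<..d} (x + y + s))
       \<le> rad_exp bs (\<lambda>s. indicat_real {2*r - d<..<2*r - c + 2*b} (x + y + s))"
  proof (cases "x + y \<le> r")
    case True
    then show ?thesis by (intro Cons.IH) (use Cons.prems in auto)
  next
    case False
    have "rad_exp bs (\<lambda>s. indicat_real {c<..d} (x + y + s))
        = rad_exp bs (\<lambda>s. indicat_real {c<..d} (x + y - s))"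
      using rad_exp_uminus[of bs "\<lambda>s. indicat_real {c<..d} (x + y + s)"] by simp
    also have "\<dots> \<le> rad_exp bs (\<lambda>s. indicat_real {2*r - d<..<2*r - c + 2*b} (x + y + s))"
      using False y Cons.prems(2) by (intro rad_exp_mono) (auto simp: indicator_def)
    finally show ?thesis .
  qed
  have "x + (s + y) = x + y + s" "x + (s - y) = x - y + s" for s by auto
  then show ?case using up down by (simp only: rad_exp.simps) simp
qed auto

lemma reflection:
  fixes r :: real
  assumes "\<And>y. y \<in> set bs \<Longrightarrow> 0 \<le> y \<and> y \<le> b" "0 \<le> r" "r \<le> c"
  shows "rad_prob bs {c<..d} \<le> rad_prob bs {2*r - d<..<2*r - c + 2*b}"
  using reflection_from[of bs b 0 r c d] assms by simp

section \<open>Chains of sign changes in large steps\<close>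

text \<open>The sums along a chain in the lattice of sign vectors, each obtained from the preceding one by raising
one sign: consecutive values differ by twice a weight from \<open>{lo..hi}\<close>.\<close>

definition chain :: "real \<Rightarrow> real \<Rightarrow> nat \<Rightarrow> (nat \<Rightarrow> real) \<Rightarrow> bool" where
  "chain lo hi k u \<longleftrightarrow> (\<forall>j<k. 2 * lo \<le> u (Suc j) - u j \<and> u (Suc j) - u j \<le> 2 * hi)"

text \<open>This is the dual form of a symmetric chain decomposition: the uniform law on sign vectors is a mixture
of uniform laws on chains, so a function whose sum over every chain is nonnegative has nonnegative
expectation. A new coordinate of weight \<open>x\<close> splits \<open>chain \<times> {-1, 1}\<close> into two chains: the old
chain with sign \<open>-1\<close> followed by its top with sign \<open>1\<close>, and the old chain without its top with
sign \<open>1\<close>. The bound on \<open>u 0\<close> says that chains start low; a chain with \<open>k\<close> steps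
can afford to start \<open>x\<close> higher once it loses a step, because weights are added in decreasing
order.\<close>

lemma rad_exp_nonneg_by_chains:
  fixes xs :: "real list"
  assumes "sorted_wrt (\<ge>) xs" "\<And>x. x \<in> set xs \<Longrightarrow> b \<le> x \<and> lo \<le> x \<and> x \<le> hi"
    and F: "\<And>k u. chain lo hi k u \<Longrightarrow> u 0 \<le> - (real k * b) \<Longrightarrow> 0 \<le> (\<Sum>j\<le>k. F (u j))"
  shows "0 \<le> rad_exp xs F"
  using assms
proof (induction xs arbitrary: F b rule: rev_induct)
  case Nil
  then show ?case using Nil(3)[of 0 "\<lambda>_. 0"] by (simp add: chain_def)
next
  case (snoc x xs)
  have x: "b \<le> x" "lo \<le> x" "x \<le> hi" using snoc.prems(2)[of x] by auto
  define F' where "F' = (\<lambda>u. (F (u + x) + F (u - x)) / 2)"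
  have "0 \<le> rad_exp xs F'"
  proof (rule snoc.IH[where b = x])
    show "sorted_wrt (\<ge>) xs" using snoc.prems(1) by (simp add: sorted_wrt_append)
    show "x \<le> y \<and> lo \<le> y \<and> y \<le> hi" if "y \<in> set xs" for y
      using snoc.prems(1,2) that by (auto simp: sorted_wrt_append)
    fix k u assume u: "chain lo hi k u" "u 0 \<le> - (real k * x)"
    define v where "v = (\<lambda>j. if j \<le> k then u j - x else u k + x)"
    have "0 \<le> (\<Sum>j\<le>Suc k. F (v j))"
    proof (rule snoc.prems(3))
      show "chain lo hi (Suc k) v" using u(1) x by (auto simp: chain_def v_def less_Suc_eq)
      have "real k * b \<le> real k * x" using x by (intro mult_left_mono) auto
      then show "v 0 \<le> - (real (Suc k) * b)" using u(2) x by (auto simp: v_def algebra_simps)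
    qed
    also have "(\<Sum>j\<le>Suc k. F (v j)) = (\<Sum>j\<le>k. F (u j - x)) + F (u k + x)"
      by (simp add: v_def)
    finally have 1: "0 \<le> (\<Sum>j\<le>k. F (u j - x)) + F (u k + x)" .
    have 2: "0 \<le> (\<Sum>j<k. F (u j + x))"
    proof (cases k)
      case (Suc k')
      have "0 \<le> (\<Sum>j\<le>k'. F (u j + x))"
      proof (rule snoc.prems(3))
        show "chain lo hi k' (\<lambda>j. u j + x)" using u(1) Suc by (auto simp: chain_def)
        have "real k' * b \<le> real k' * x" using x by (intro mult_left_mono) auto
        then show "u 0 + x \<le> - (real k' * b)" using u(2) x Suc by (auto simp: algebra_simps)
      qed
      then show ?thesis using Suc by (simp add: lessThan_Suc_atMost)
    qed simp
    have "(\<Sum>j\<le>k. F' (u j)) = ((\<Sum>j\<le>k. F (u j + x)) + (\<Sum>j\<le>k. F (u j - x))) / 2"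
      by (simp add: F'_def sum.distrib sum_divide_distrib[symmetric])
    also have "(\<Sum>j\<le>k. F (u j + x)) = (\<Sum>j<k. F (u j + x)) + F (u k + x)"
      by (simp add: lessThan_Suc_atMost[symmetric])
    finally show "0 \<le> (\<Sum>j\<le>k. F' (u j))" using 1 2 by simp
  qed
  then show ?case by (simp add: rad_exp_append F'_def)
qed

lemma chain_gap:
  assumes "chain lo hi k u" "i < j" "j \<le> k" "0 \<le> lo"
  shows "u i + 2 * lo \<le> u j"
  using assms(2,3)
proof (induction j)
  case (Suc j)
  have "2 * lo \<le> u (Suc j) - u j" using assms(1) Suc by (auto simp: chain_def)
  then show ?case using Suc assms(4) by (cases "i = j") auto
qed simp

text \<open>If all weights are at least \<open>a / 2\<close>, a chain moves by at least \<open>a\<close> in each step and meets the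
interval of length \<open>a / 2\<close> at most once. Since it starts at or below \<open>p + 2 * a\<close> and its steps are at most
\<open>2 * a\<close>, it cannot have arrived there without meeting the half-open interval of length
\<open>2 * a\<close> on its way.\<close>

lemma large_steps_shift:
  fixes xs :: "real list"
  assumes "sorted_wrt (\<ge>) xs" "\<And>x. x \<in> set xs \<Longrightarrow> a / 2 \<le> x \<and> x \<le> a"
    and a: "0 < a" and "0 \<le> p + 2 * a" "p + 2 * a \<le> q"
  shows "rad_prob xs {q<..q + a / 2} \<le> rad_prob xs {p<..p + 2 * a}"
proof -
  have "0 \<le> rad_exp xs (\<lambda>s. indicat_real {p<..p + 2 * a} s - indicat_real {q<..q + a / 2} s)"
  proof (rule rad_exp_nonneg_by_chains[where b = 0 and lo = "a / 2" and hi = a])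
    fix k u assume u: "chain (a / 2) a k u" "u 0 \<le> - (real k * 0)"
    let ?A = "{j \<in> {..k}. u j \<in> {p<..p + 2 * a}}" and ?B = "{j \<in> {..k}. u j \<in> {q<..q + a / 2}}"
    have "card ?B \<le> card ?A"
    proof (cases "?B = {}")
      case False
      then obtain j where j: "j \<le> k" "u j \<in> {q<..q + a / 2}" by auto
      have "?B \<subseteq> {j}"
      proof
        fix i assume i: "i \<in> ?B"
        show "i \<in> {j}"
          using chain_gap[OF u(1), of i j] chain_gap[OF u(1), of j i] i j assms(3)
          by (cases i j rule: linorder_cases) auto
      qed
      then have "card ?B \<le> card {j}" by (rule card_mono[rotated]) simp
      then have B: "card ?B \<le> 1" by simp
      \<comment> \<open>The first position above the interval of length \<open>2 * a\<close>; its predecessor lies in that interval.\<close>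
      define i where "i = (LEAST i. p + 2 * a < u i)"
      have "p + 2 * a < u j" using j assms by auto
      then have i: "p + 2 * a < u i" "i \<le> j" unfolding i_def by (auto intro: LeastI Least_le)
      obtain i' where i': "i = Suc i'" using i u(2) assms(4) by (cases i) auto
      have "\<not> p + 2 * a < u i'" using not_less_Least[of i' "\<lambda>i. p + 2 * a < u i"] i' i_def by auto
      moreover have "u i - u i' \<le> 2 * a" using u(1) i i' j by (auto simp: chain_def)
      ultimately have "i' \<in> ?A" using i i' j by auto
      then have "card ?A > 0" by (auto simp: card_gt_0_iff)
      then show ?thesis using B by simp
    next
      case True
      then show ?thesis by (simp only: card.empty)
    qed
    moreover have "(\<Sum>j\<le>k. indicat_real C (u j)) = real (card {j \<in> {..k}. u j \<in> C})" for C
      by (simp add: indicator_def sum.If_cases Int_def of_bool_def)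
    ultimately show "0 \<le> (\<Sum>j\<le>k. indicat_real {p<..p + 2 * a} (u j) - indicat_real {q<..q + a / 2} (u j))"
      by (simp add: sum_subtractf)
  next
    fix x assume "x \<in> set xs"
    then show "0 \<le> x \<and> a / 2 \<le> x \<and> x \<le> a" using assms(2)[of x] a by auto
  qed fact
  then show ?thesis by (simp add: rad_exp_diff)
qed

section \<open>Windows far from the origin are not much heavier\<close>

text \<open>Reflection overshoots by up to twice a step, so with steps near \<open>a\<close> it may miss an interval of
length \<open>2 * a\<close>; chains of small steps, on the other hand, may visit the short interval many times.
Hence the sum is written as \<open>u + v\<close> with \<open>u\<close> from the weights at least \<open>a / 2\<close> and
\<open>v\<close> from the smaller ones. If \<open>v \<le> t + a\<close>, then \<open>u\<close> is moved along chains. Otherwise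
\<open>u \<le> a / 2\<close>, and then \<open>v\<close> can be reflected with overshoot less than \<open>a\<close>. Each of the
two cases contributes at most the mass of the target.\<close>

lemma halfstep_shift:
  fixes ys :: "real list"
  assumes sorted: "sorted_wrt (\<ge>) ys" and ys: "\<And>y. y \<in> set ys \<Longrightarrow> 0 \<le> y \<and> y \<le> a"
    and a: "0 < a" and t: "0 \<le> t"
  shows "rad_prob ys {t + a<..t + a + a / 2} \<le> 2 * rad_prob ys {t - a<..t + a}"
proof -
  define A where "A = {t - a<..t + a}"
  define B where "B = {t + a<..t + a + a / 2}"
  define L where "L = filter (\<lambda>y. a / 2 \<le> y) ys"
  define S where "S = filter (\<lambda>y. \<not> a / 2 \<le> y) ys"
  have split: "ys = L @ S"
    using sorted unfolding L_def S_def
  proof (induction ys)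
    case (Cons y ys)
    show ?case
    proof (cases "a / 2 \<le> y")
      case True
      then show ?thesis using Cons by simp
    next
      case False
      then have "filter ((\<le>) (a / 2)) ys = []" using Cons.prems by (force simp: filter_empty_conv)
      then show ?thesis using False Cons by (simp del: less_divide_eq_numeral1 le_divide_eq_numeral1 divide_le_eq_numeral1 not_le)
    qed
  qed simp
  have LS: "rad_exp ys F = rad_exp L (\<lambda>u. rad_exp S (\<lambda>v. F (u + v)))" for F
    by (subst split) (simp only: rad_exp_append)
  have "sorted_wrt (\<ge>) L" using sorted by (simp add: L_def sorted_wrt_filter)
  then have large: "rad_exp L (\<lambda>u. indicat_real B (u + v)) \<le> rad_exp L (\<lambda>u. indicat_real A (u + v))"
    if "v \<le> t + a" for v
  proof -
    have "rad_prob L {t + a - v<..t + a - v + a / 2} \<le> rad_prob L {t - a - v<..t - a - v + 2 * a}"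
      by (rule large_steps_shift) (use \<open>sorted_wrt (\<ge>) L\<close> ys a that in \<open>auto simp: L_def\<close>)
    moreover have "indicat_real {t + a - v<..t + a - v + a / 2} = (\<lambda>u. indicat_real B (u + v))"
      "indicat_real {t - a - v<..t - a - v + 2 * a} = (\<lambda>u. indicat_real A (u + v))"
      by (auto simp: A_def B_def indicator_def fun_eq_iff)
    ultimately show ?thesis by simp
  qed
  have small: "rad_exp S (\<lambda>v. indicat_real B (u + v)) \<le> rad_exp S (\<lambda>v. indicat_real A (u + v))"
    if "u \<le> a / 2" for u
  proof -
    define r where "r = t + a / 2 - u"
    have "rad_prob S {t + a - u<..t + a + a / 2 - u} \<le>
      rad_prob S {2 * r - (t + a + a / 2 - u)<..<2 * r - (t + a - u) + 2 * (a / 2)}"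
      by (rule reflection) (use ys a t that in \<open>auto simp: S_def r_def\<close>)
    also have "\<dots> \<le> rad_prob S {t - a - u<..t + a - u}"
      using a by (intro rad_prob_mono) (auto simp: r_def)
    finally have "rad_prob S {t + a - u<..t + a + a / 2 - u} \<le> rad_prob S {t - a - u<..t + a - u}" .
    moreover have "indicat_real {t + a - u<..t + a + a / 2 - u} = (\<lambda>v. indicat_real B (u + v))"
      "indicat_real {t - a - u<..t + a - u} = (\<lambda>v. indicat_real A (u + v))"
      by (auto simp: A_def B_def indicator_def fun_eq_iff)
    ultimately show ?thesis by simp
  qed
  have "rad_prob ys B \<le> rad_exp L (\<lambda>u. rad_exp S (\<lambda>v.
      of_bool (v \<le> t + a) * indicat_real B (u + v) + of_bool (u \<le> a / 2) * indicat_real B (u + v)))"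
    unfolding LS using t by (intro rad_exp_mono) (auto simp: indicator_def B_def)
  also have "\<dots> = rad_exp S (\<lambda>v. of_bool (v \<le> t + a) * rad_exp L (\<lambda>u. indicat_real B (u + v)))
      + rad_exp L (\<lambda>u. of_bool (u \<le> a / 2) * rad_exp S (\<lambda>v. indicat_real B (u + v)))"
    by (simp add: rad_exp_add rad_exp_cmult rad_exp_swap[of L S "\<lambda>u v. of_bool (v \<le> t + a) * indicat_real B (u + v)"])
  also have "\<dots> \<le> rad_exp S (\<lambda>v. rad_exp L (\<lambda>u. indicat_real A (u + v)))
      + rad_exp L (\<lambda>u. rad_exp S (\<lambda>v. indicat_real A (u + v)))"
    using large small rad_prob_nonneg
    by (intro add_mono rad_exp_mono) (auto simp: of_bool_def intro!: rad_exp_nonneg)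
  also have "\<dots> = 2 * rad_prob ys A"
    unfolding LS by (simp add: rad_exp_swap[of S L])
  finally show ?thesis by (simp add: A_def B_def)
qed

text \<open>With \<open>ys\<close> all weights but the largest one, \<open>a\<close>, this is the influence of the coordinate
of weight \<open>a\<close> at threshold \<open>s\<close>: its sign decides whether the threshold is exceeded exactly when the other coordinates sum
to a value in the window.\<close>

definition window :: "real list \<Rightarrow> real \<Rightarrow> real \<Rightarrow> real" where
  "window ys a s = rad_prob ys {s - a<..s + a}"

text \<open>Reflecting the whole walk brings a far window into the union of the windows at \<open>t\<close> and
\<open>t + 2 * a\<close>; four shifts by \<open>a / 2\<close>, each at the price of a factor 3, compare the second
of these with the first. This gives \<open>82 = 1 + 3 ^ 4\<close>.\<close>

lemma window_le_window:
  fixes ys :: "real list"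
  assumes sorted: "sorted_wrt (\<ge>) ys" and ys: "\<And>y. y \<in> set ys \<Longrightarrow> 0 \<le> y \<and> y \<le> a"
    and a: "0 < a" and t: "0 \<le> t" "t \<le> s"
  shows "window ys a s \<le> 82 * window ys a t"
proof -
  have half: "window ys a (r + a / 2) \<le> 3 * window ys a r" if "0 \<le> r" for r
  proof -
    have "window ys a (r + a / 2) \<le> rad_prob ys ({r - a<..r + a} \<union> {r + a<..r + a + a / 2})"
      unfolding window_def using a by (intro rad_prob_mono) auto
    also have "\<dots> \<le> window ys a r + rad_prob ys {r + a<..r + a + a / 2}"
      unfolding window_def by (rule rad_prob_union_le)
    finally show ?thesis using halfstep_shift[OF sorted ys a that] by (simp add: window_def)
  qed
  have "window ys a (t + 2 * a) \<le> 81 * window ys a t"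
    using half[of t] half[of "t + a / 2"] half[of "t + a"] half[of "t + 3 * a / 2"] t a
    by (simp add: algebra_simps)
  moreover have "window ys a s \<le> rad_prob ys ({t - a<..t + a} \<union> {t + 2 * a - a<..t + 2 * a + a})"
  proof (cases "s < t + 2 * a")
    case True
    then show ?thesis unfolding window_def using t by (intro rad_prob_mono) auto
  next
    case False
    have "window ys a s \<le> rad_prob ys {2 * ((s + t) / 2) - (s + a)<..<2 * ((s + t) / 2) - (s - a) + 2 * a}"
      unfolding window_def by (rule reflection) (use ys a t False in auto)
    also have "\<dots> \<le> rad_prob ys ({t - a<..t + a} \<union> {t + 2 * a - a<..t + 2 * a + a})"
      using a by (intro rad_prob_mono) (auto simp: field_simps)
    finally show ?thesis .
  qed
  moreover have "\<dots> \<le> window ys a t + window ys a (t + 2 * a)"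
    unfolding window_def by (rule rad_prob_union_le)
  ultimately show ?thesis by linarith
qed

section \<open>Logarithmic Sobolev inequality and local Chernoff bound\<close>

text \<open>The entropy of a function with the two values \<open>p\<^sup>2\<close> and \<open>q\<^sup>2\<close> is at most
\<open>(p - q)\<^sup>2\<close>. The estimate \<open>ln x \<le> x - 1\<close> bounds it by
\<open>(p\<^sup>2 - q\<^sup>2)\<^sup>2 / (2 * (p\<^sup>2 + q\<^sup>2))\<close>, which loses only a constant factor.\<close>

lemma two_point_entropy:
  fixes A B :: real
  assumes "0 \<le> A" "0 \<le> B"
  shows "(A * ln A + B * ln B) / 2 - (A + B) / 2 * ln ((A + B) / 2) \<le> A + B - 2 * sqrt (A * B)"
proof (cases "A + B = 0")
  case True
  then show ?thesis using assms by (simp add: add_nonneg_eq_0_iff)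
next
  case False
  define M where "M = (A + B) / 2"
  have M: "M > 0" using False assms by (simp add: M_def)
  have ln_le: "C * ln C - C * ln M \<le> C * (C - M) / M" if "0 \<le> C" for C
  proof (cases "C = 0")
    case False
    then have C: "C > 0" using that by simp
    have "C * (ln C - ln M) \<le> C * (C / M - 1)"
      using ln_le_minus_one[of "C / M"] C M by (intro mult_left_mono) (auto simp: ln_div)
    then show ?thesis using M by (simp add: field_simps)
  qed simp
  have "(A * ln A + B * ln B) / 2 - M * ln M \<le> (A * (A - M) / M + B * (B - M) / M) / 2"
  proof -
    have "M * ln M = (A * ln M + B * ln M) / 2" by (simp add: M_def algebra_simps)
    then show ?thesis using ln_le[OF assms(1)] ln_le[OF assms(2)] by argo
  qed
  also have "\<dots> = (A - B)\<^sup>2 / (4 * M)"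
    using M by (simp add: field_simps) (simp add: M_def field_simps power2_eq_square)
  also have "\<dots> \<le> A + B - 2 * sqrt (A * B)"
  proof -
    define p q where "p = sqrt A" and "q = sqrt B"
    have pq: "A = p\<^sup>2" "B = q\<^sup>2" "sqrt (A * B) = p * q" using assms by (auto simp: p_def q_def real_sqrt_mult)
    have "(A - B)\<^sup>2 = (p - q)\<^sup>2 * (p + q)\<^sup>2" by (simp add: pq power2_eq_square algebra_simps)
    also have "\<dots> \<le> (p - q)\<^sup>2 * (4 * M)"
      using zero_le_power2[of "p - q"] by (intro mult_left_mono) (auto simp: M_def pq power2_eq_square algebra_simps)
    finally have "(A - B)\<^sup>2 / (4 * M) \<le> (p - q)\<^sup>2" using M by (simp add: pos_divide_le_eq)
    moreover have "(p - q)\<^sup>2 = A + B - 2 * sqrt (A * B)"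
      unfolding pq(3) by (simp add: pq(1,2) power2_eq_square algebra_simps)
    ultimately show ?thesis by simp
  qed
  finally show ?thesis by (simp add: M_def)
qed

lemma rad_exp_Cauchy_Schwarz:
  "rad_exp bs (\<lambda>s. F s * G s) \<le> sqrt (rad_exp bs (\<lambda>s. (F s)\<^sup>2) * rad_exp bs (\<lambda>s. (G s)\<^sup>2))"
proof (induction bs arbitrary: F G)
  case (Cons b bs)
  let ?E = "rad_exp bs"
  define p q p' q' where "p = sqrt (?E (\<lambda>s. (F (s + b))\<^sup>2))" and "q = sqrt (?E (\<lambda>s. (G (s + b))\<^sup>2))"
    and "p' = sqrt (?E (\<lambda>s. (F (s - b))\<^sup>2))" and "q' = sqrt (?E (\<lambda>s. (G (s - b))\<^sup>2))"
  have sq: "?E (\<lambda>s. (F (s + b))\<^sup>2) = p\<^sup>2" "?E (\<lambda>s. (G (s + b))\<^sup>2) = q\<^sup>2"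
    "?E (\<lambda>s. (F (s - b))\<^sup>2) = p'\<^sup>2" "?E (\<lambda>s. (G (s - b))\<^sup>2) = q'\<^sup>2"
    by (auto simp: p_def q_def p'_def q'_def intro!: real_sqrt_pow2[symmetric] rad_exp_nonneg)
  have "?E (\<lambda>s. F (s + b) * G (s + b)) \<le> p * q" "?E (\<lambda>s. F (s - b) * G (s - b)) \<le> p' * q'"
    unfolding p_def q_def p'_def q'_def real_sqrt_mult[symmetric] by (rule Cons.IH)+
  then have "rad_exp (b # bs) (\<lambda>s. F s * G s) \<le> (p * q + p' * q') / 2"
    by simp
  also have "\<dots> \<le> sqrt ((p\<^sup>2 + p'\<^sup>2) / 2 * ((q\<^sup>2 + q'\<^sup>2) / 2))"
  proof (rule real_le_rsqrt)
    have "0 \<le> (p * q' - p' * q)\<^sup>2" by simp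
    then show "((p * q + p' * q') / 2)\<^sup>2 \<le> (p\<^sup>2 + p'\<^sup>2) / 2 * ((q\<^sup>2 + q'\<^sup>2) / 2)"
      by (simp add: power2_eq_square field_simps)
  qed
  finally show ?case by (simp add: sq)
qed (simp add: real_sqrt_mult abs_mult[symmetric])

text \<open>The sum over all coordinates of the mean squared difference of \<open>G\<close> (evaluated at the weighted sum) across
the coordinate.\<close>

primrec dirichlet :: "real list \<Rightarrow> (real \<Rightarrow> real) \<Rightarrow> real" where
  "dirichlet [] G = 0"
| "dirichlet (b # bs) G = rad_exp bs (\<lambda>s. (G (s + b) - G (s - b))\<^sup>2)
     + (dirichlet bs (\<lambda>s. G (s + b)) + dirichlet bs (\<lambda>s. G (s - b))) / 2"

text \<open>Entropy tensorizes: the entropy over \<open>b # bs\<close> is the mean of the two conditional entropies plus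
the two-point entropy of the conditional second moments, and by Cauchy-Schwarz the latter is at most the
energy in the direction \<open>b\<close>.\<close>

lemma log_Sobolev:
  fixes bs :: "real list"
  shows "rad_exp bs (\<lambda>s. (G s)\<^sup>2 * ln ((G s)\<^sup>2))
    - rad_exp bs (\<lambda>s. (G s)\<^sup>2) * ln (rad_exp bs (\<lambda>s. (G s)\<^sup>2)) \<le> dirichlet bs G"
proof (induction bs arbitrary: G)
  case (Cons b bs)
  let ?E = "rad_exp bs"
  define A B where "A = ?E (\<lambda>s. (G (s + b))\<^sup>2)" and "B = ?E (\<lambda>s. (G (s - b))\<^sup>2)"
  have nonneg: "0 \<le> A" "0 \<le> B" by (auto simp: A_def B_def intro!: rad_exp_nonneg)
  have "A + B - 2 * sqrt (A * B) \<le> A + B - 2 * ?E (\<lambda>s. G (s + b) * G (s - b))"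
    using rad_exp_Cauchy_Schwarz[of bs "\<lambda>s. G (s + b)" "\<lambda>s. G (s - b)"] by (simp add: A_def B_def)
  also have "\<dots> = ?E (\<lambda>s. (G (s + b))\<^sup>2 + (G (s - b))\<^sup>2 - 2 * (G (s + b) * G (s - b)))"
    by (simp add: A_def B_def rad_exp_add rad_exp_diff rad_exp_cmult)
  also have "\<dots> = ?E (\<lambda>s. (G (s + b) - G (s - b))\<^sup>2)"
    by (simp add: power2_eq_square algebra_simps)
  finally have "(A * ln A + B * ln B) / 2 - (A + B) / 2 * ln ((A + B) / 2)
      \<le> ?E (\<lambda>s. (G (s + b) - G (s - b))\<^sup>2)"
    using two_point_entropy[OF nonneg] by linarith
  then show ?case
    using Cons.IH[of "\<lambda>s. G (s + b)"] Cons.IH[of "\<lambda>s. G (s - b)"]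
    unfolding A_def[symmetric] B_def[symmetric]
    by (simp add: A_def[symmetric] B_def[symmetric] del: times_divide_eq_left) argo
qed simp

text \<open>Each edge of the cube is charged to its upper endpoint, so only endpoints with sum in \<open>U\<close>
contribute, each at most \<open>K\<close> times the sum of the squared weights. The factor 2 arises because the upper
endpoint of an edge is a point conditioned to have sign 1.\<close>

lemma dirichlet_le:
  fixes bs :: "real list"
  assumes "\<And>b s. b \<in> set bs \<Longrightarrow> (G (s + b) - G (s - b))\<^sup>2 \<le> K * b\<^sup>2 * indicat_real U (s + b)" "0 \<le> K"
  shows "dirichlet bs G \<le> 2 * K * (\<Sum>b\<leftarrow>bs. b\<^sup>2) * rad_prob bs U"
  using assms
proof (induction bs arbitrary: G U)
  case (Cons b bs)
  let ?P = "rad_exp bs (\<lambda>s. indicat_real U (s + b))" and ?M = "rad_exp bs (\<lambda>s. indicat_real U (s - b))"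
  have "rad_exp bs (\<lambda>s. (G (s + b) - G (s - b))\<^sup>2) \<le> rad_exp bs (\<lambda>s. K * b\<^sup>2 * indicat_real U (s + b))"
    by (intro rad_exp_mono Cons.prems) auto
  also have "\<dots> \<le> K * b\<^sup>2 * (?P + ?M)"
    using Cons.prems(2) by (auto simp: rad_exp_cmult intro!: mult_left_mono rad_exp_nonneg)
  finally have 1: "rad_exp bs (\<lambda>s. (G (s + b) - G (s - b))\<^sup>2) \<le> K * b\<^sup>2 * (?P + ?M)" .
  have IH: "dirichlet bs (\<lambda>s. G (s + h)) \<le> 2 * K * (\<Sum>b\<leftarrow>bs. b\<^sup>2) * rad_exp bs (\<lambda>s. indicat_real U (s + h))" for h
  proof -
    have "dirichlet bs (\<lambda>s. G (s + h)) \<le> 2 * K * (\<Sum>b\<leftarrow>bs. b\<^sup>2) * rad_prob bs {s. s + h \<in> U}"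
    proof (rule Cons.IH)
      fix c s assume "c \<in> set bs"
      then show "(G (s + c + h) - G (s - c + h))\<^sup>2 \<le> K * c\<^sup>2 * indicat_real {s. s + h \<in> U} (s + c)"
        using Cons.prems(1)[of c "s + h"] by (simp add: indicator_def algebra_simps)
    qed (rule Cons.prems)
    moreover have "indicat_real {s. s + h \<in> U} = (\<lambda>s. indicat_real U (s + h))"
      by (auto simp: indicator_def)
    ultimately show ?thesis by simp
  qed
  show ?case using 1 IH[of b] IH[of "- b"] by (simp add: algebra_simps add_divide_distrib)
qed simp

text \<open>A local form of the Chernoff bound, in the spirit of Devroye and Lugosi: moving the threshold by a multiple of
\<open>1 / sqrt (ln (1 / m))\<close> reduces the tail by a constant factor. The logarithmic Sobolev
inequality is applied to the linear ramp \<open>G\<close> from 0 at \<open>t\<close> to 1 at \<open>t + d\<close>. Its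
energy is at most \<open>8 * m / d\<^sup>2\<close>, and the entropy of \<open>G\<^sup>2\<close>, which lives on a set of
probability \<open>m\<close>, is at least \<open>ln (1 / m)\<close> times the mean of \<open>G\<^sup>2\<close>.\<close>

lemma local_Chernoff:
  fixes bs :: "real list" and t :: real
  defines "m \<equiv> rad_prob bs {t<..}"
  assumes norm: "(\<Sum>b\<leftarrow>bs. b\<^sup>2) = 1" and nonneg: "\<And>b. b \<in> set bs \<Longrightarrow> 0 \<le> b"
    and "0 < d" "0 < m"
  shows "rad_prob bs {t + d<..} * ln (1 / m) \<le> 8 * m / d\<^sup>2"
proof (cases "m < 1")
  case False
  then have "ln (1 / m) \<le> 0" using \<open>0 < m\<close> by (simp add: ln_div)
  then have "rad_prob bs {t + d<..} * ln (1 / m) \<le> 0" by (intro mult_nonneg_nonpos rad_prob_nonneg)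
  also have "0 \<le> 8 * m / d\<^sup>2" using assms by simp
  finally show ?thesis .
next
  case True
  define G where "G = (\<lambda>s. min 1 (max 0 ((s - t) / d)))"
  define M where "M = rad_exp bs (\<lambda>s. (G s)\<^sup>2)"
  have G0: "s \<le> t \<Longrightarrow> G s = 0" and Gpos: "t < s \<Longrightarrow> 0 < G s" for s
    using \<open>0 < d\<close> by (auto simp: G_def min_def max_def field_simps)
  have "rad_prob bs {t + d<..} \<le> M"
    unfolding M_def using \<open>0 < d\<close> by (intro rad_exp_mono) (auto simp: indicator_def G_def field_simps)
  moreover have "M * ln (1 / m) \<le> 8 * m / d\<^sup>2"
  proof (cases "M = 0")
    case False
    then have M: "0 < M" using rad_exp_nonneg[of "\<lambda>s. (G s)\<^sup>2" bs] by (simp add: M_def)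
    \<comment> \<open>The bound \<open>ln x \<le> x - 1\<close>, applied so that the left-hand sides average to 0 and the right-hand sides to the entropy minus \<open>M * ln (1 / m)\<close>.\<close>
    have gibbs: "(G s)\<^sup>2 - M / m * indicat_real {t<..} s \<le> (G s)\<^sup>2 * ln ((G s)\<^sup>2) - (G s)\<^sup>2 * ln (M / m)" for s
    proof (cases "t < s")
      case True
      define y where "y = (G s)\<^sup>2"
      have y: "0 < y" using Gpos[OF True] by (simp add: y_def)
      have "ln (M / m / y) \<le> M / m / y - 1" using y M \<open>0 < m\<close> by (intro ln_le_minus_one) simp
      then have "y * (ln (M / m) - ln y) \<le> y * (M / m / y - 1)"
        using y M \<open>0 < m\<close> by (intro mult_left_mono) (auto simp: ln_div ln_mult)
      then have "y - M / m \<le> y * ln y - y * ln (M / m)"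
        using y by (simp add: algebra_simps)
      then show ?thesis using True by (simp add: y_def)
    qed (simp add: G0)
    have "0 = rad_exp bs (\<lambda>s. (G s)\<^sup>2 - M / m * indicat_real {t<..} s)"
      using \<open>0 < m\<close> unfolding rad_exp_diff rad_exp_cmult M_def[symmetric] m_def[symmetric] by simp
    also have "\<dots> \<le> rad_exp bs (\<lambda>s. (G s)\<^sup>2 * ln ((G s)\<^sup>2) - ln (M / m) * (G s)\<^sup>2)"
      using gibbs by (intro rad_exp_mono) (simp add: mult.commute)
    also have "\<dots> = rad_exp bs (\<lambda>s. (G s)\<^sup>2 * ln ((G s)\<^sup>2)) - ln (M / m) * M"
      by (simp add: rad_exp_diff rad_exp_cmult M_def)
    also have "\<dots> \<le> dirichlet bs G + M * ln M - ln (M / m) * M"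
      using log_Sobolev[of bs G] by (simp add: M_def)
    also have "\<dots> = dirichlet bs G - M * ln (1 / m)"
      using M \<open>0 < m\<close> by (simp add: ln_div algebra_simps)
    also have "dirichlet bs G \<le> 2 * (4 / d\<^sup>2) * (\<Sum>b\<leftarrow>bs. b\<^sup>2) * rad_prob bs {t<..}"
    proof (rule dirichlet_le)
      fix b s assume "b \<in> set bs"
      then have b: "0 \<le> b" by (rule nonneg)
      show "(G (s + b) - G (s - b))\<^sup>2 \<le> 4 / d\<^sup>2 * b\<^sup>2 * indicat_real {t<..} (s + b)"
      proof (cases "t < s + b")
        case True
        have "\<bar>G (s + b) - G (s - b)\<bar> \<le> \<bar>2 * b / d\<bar>"
        proof -
          have "(s + b - t) / d = (s - b - t) / d + 2 * b / d" "0 \<le> 2 * b / d"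
            using \<open>0 < d\<close> b by (auto simp: field_simps)
          then show ?thesis unfolding G_def by linarith
        qed
        then have "(G (s + b) - G (s - b))\<^sup>2 \<le> (2 * b / d)\<^sup>2" by (simp only: abs_le_square_iff)
        then show ?thesis using True by (simp add: power_divide power_mult_distrib)
      qed (use b in \<open>simp add: G0\<close>)
    qed simp
    finally show ?thesis by (simp add: norm m_def)
  qed (use \<open>0 < m\<close> in simp)
  moreover have "0 \<le> ln (1 / m)" using True \<open>0 < m\<close> by (simp add: ln_div)
  ultimately show ?thesis by (meson mult_right_mono order_trans)
qed

section \<open>Exponential moments and the upper bound\<close>

text \<open>The auxiliary function of Hoeffding's lemma at \<open>p = 1 / 2\<close> and \<open>h = 2 * y\<close> is \<open>ln (cosh y)\<close>.\<close>

lemma cosh_le_exp: "(exp x + exp (- x)) / 2 \<le> exp (x\<^sup>2 / 2)" for x :: real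
proof -
  have *: "(exp y + exp (- y)) / 2 \<le> exp (y\<^sup>2 / 2)" if "0 \<le> y" for y :: real
  proof -
    have pos: "0 < 1 + (exp (2 * y) - 1) / 2" using exp_gt_zero[of "2 * y"] by argo
    have "exp (- (2 * y) * (1/2) + ln (1 + 1/2 * (exp (2 * y) - 1))) \<le> exp ((2 * y)\<^sup>2 / 8)"
      using Hoeffdings_lemma_aux[of "2 * y" "1/2"] that by simp
    also have "exp (- (2 * y) * (1/2) + ln (1 + 1/2 * (exp (2 * y) - 1)))
        = exp (- y) * (1 + (exp (2 * y) - 1) / 2)"
      using pos by (simp add: exp_diff exp_minus field_simps)
    also have "\<dots> = (exp y + exp (- y)) / 2"
      by (simp add: field_simps exp_add[symmetric] exp_minus_inverse)
    finally show ?thesis by simp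
  qed
  show ?thesis using *[of x] *[of "- x"] by (cases "0 \<le> x") (auto simp: add.commute)
qed

lemma rad_exp_exp_le:
  fixes bs :: "real list"
  shows "rad_exp bs (\<lambda>s. exp (l * s)) \<le> exp (l\<^sup>2 * (\<Sum>b\<leftarrow>bs. b\<^sup>2) / 2)"
proof (induction bs)
  case (Cons b bs)
  let ?E = "rad_exp bs (\<lambda>s. exp (l * s))"
  have "rad_exp (b # bs) (\<lambda>s. exp (l * s)) = (exp (l * b) + exp (- (l * b))) / 2 * ?E"
    using rad_exp_cmult[of bs "exp (l * b)" "\<lambda>s. exp (l * s)"]
      rad_exp_cmult[of bs "exp (- (l * b))" "\<lambda>s. exp (l * s)"]
    by (simp add: algebra_simps exp_add[symmetric] exp_diff exp_minus field_simps)
  also have "\<dots> \<le> exp ((l * b)\<^sup>2 / 2) * exp (l\<^sup>2 * (\<Sum>b\<leftarrow>bs. b\<^sup>2) / 2)"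
    by (intro mult_mono cosh_le_exp Cons.IH rad_exp_nonneg) auto
  finally show ?case by (simp add: exp_add[symmetric] power_mult_distrib algebra_simps add_divide_distrib)
qed simp

text \<open>The level-1 inequality. The tangent bound \<open>1 + z \<le> exp z\<close> trades the linear function on the half-line for
an exponential moment; the choice \<open>l\<^sup>2 = 2 * ln (1 / m)\<close> makes the exponential term equal
to \<open>m\<close>.\<close>

lemma first_moment_above_le:
  fixes bs :: "real list" and t :: real
  defines "m \<equiv> rad_prob bs {t<..}"
  assumes norm: "(\<Sum>b\<leftarrow>bs. b\<^sup>2) = 1" and m: "0 < m" "m < 1"
  shows "rad_exp bs (\<lambda>s. indicat_real {t<..} s * s) \<le> m * sqrt (2 * ln (1 / m))"
proof -
  define L where "L = ln (1 / m)"
  define l where "l = sqrt (2 * L)"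
  have L: "0 < L" "exp L = 1 / m" using m by (auto simp: L_def)
  have l: "0 < l" "l\<^sup>2 = 2 * L" using L by (auto simp: l_def)
  have "l * rad_exp bs (\<lambda>s. indicat_real {t<..} s * s) = rad_exp bs (\<lambda>s. l * (indicat_real {t<..} s * s))"
    by (simp add: rad_exp_cmult)
  also have "\<dots> \<le> rad_exp bs (\<lambda>s. (2 * L - 1) * indicat_real {t<..} s + exp (- (2 * L)) * exp (l * s))"
  proof (rule rad_exp_mono)
    fix s
    have "1 + (l * s - 2 * L) \<le> exp (l * s - 2 * L)" by (rule exp_ge_add_one_self)
    also have "\<dots> = exp (- (2 * L)) * exp (l * s)" by (simp add: exp_add[symmetric])
    finally have *: "1 + (l * s - 2 * L) \<le> exp (- (2 * L)) * exp (l * s)" .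
    show "l * (indicat_real {t<..} s * s) \<le> (2 * L - 1) * indicat_real {t<..} s + exp (- (2 * L)) * exp (l * s)"
      using * by (cases "t < s") auto
  qed
  also have "\<dots> = (2 * L - 1) * m + exp (- (2 * L)) * rad_exp bs (\<lambda>s. exp (l * s))"
    by (simp add: rad_exp_add rad_exp_cmult m_def)
  also have "\<dots> \<le> (2 * L - 1) * m + exp (- (2 * L)) * exp L"
    using rad_exp_exp_le[of bs l] by (simp add: norm l)
  also have "exp (- (2 * L)) * exp L = m"
  proof -
    have "exp (- (2 * L)) * exp L = exp (- L)" by (simp only: exp_add[symmetric]) simp
    then show ?thesis using m L(2) by (simp add: exp_minus)
  qed
  also have "(2 * L - 1) * m + m = l * (m * l)"
    using l(2) by (simp add: power2_eq_square algebra_simps)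
  finally show ?thesis using l(1) by (simp add: l_def L_def)
qed

text \<open>Integration by parts on the cube: in the expectation of \<open>G (x + s) * s\<close> the coordinate of weight
\<open>b\<close> contributes \<open>b\<close> times half the mean difference of \<open>G\<close> across that coordinate.
If its sign is \<open>-1\<close> and the sum lies in the window, then raising the sign moves the sum by
\<open>2 * b\<close> within the part of slope 1 of the ramp. Twice the total of \<open>b\<^sup>2\<close> over the negative
signs is \<open>(\<Sum>b\<leftarrow>as. b\<^sup>2) - snd p\<close>.\<close>

lemma ramp_moment_ge:
  fixes as :: "real list" and a t :: real
  defines "G \<equiv> (\<lambda>s. min (4 * a) (max 0 (s - t)))"
  assumes "\<And>b. b \<in> set as \<Longrightarrow> 0 \<le> b \<and> b \<le> a"
  shows "rad_exp (map (\<lambda>b. (b, b\<^sup>2)) as)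
           (\<lambda>p. indicat_real {t<..t + 2 * a} (x + fst p) * ((\<Sum>b\<leftarrow>as. b\<^sup>2) - snd p))
       \<le> rad_exp as (\<lambda>s. G (x + s) * s)"
  using assms(2)
proof (induction as arbitrary: x)
  case (Cons b bs)
  let ?ps = "map (\<lambda>b. (b, b\<^sup>2)) bs" and ?T = "\<Sum>b\<leftarrow>bs. b\<^sup>2"
  let ?W = "indicat_real {t<..t + 2 * a}"
  have b: "0 \<le> b" "b \<le> a" using Cons.prems[of b] by auto
  have IH: "rad_exp ?ps (\<lambda>p. ?W (y + fst p) * (?T - snd p)) \<le> rad_exp bs (\<lambda>s. G (y + s) * s)" for y
    by (rule Cons.IH) (use Cons.prems in auto)
  have W: "rad_exp ?ps (\<lambda>p. ?W (x - b + fst p)) = rad_exp bs (\<lambda>s. ?W (x - b + s))"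
    using rad_exp_map[of fst ?ps "\<lambda>s. ?W (x - b + s)"] by (simp add: comp_def)
  have pointwise: "2 * b\<^sup>2 * ?W (x - b + s) \<le> b * (G (x + b + s) - G (x - b + s))" for s
  proof (cases "x - b + s \<in> {t<..t + 2 * a}")
    case True
    then have "G (x + b + s) - G (x - b + s) = 2 * b" using b by (auto simp: G_def)
    then show ?thesis using True by (simp add: power2_eq_square)
  next
    case False
    have "G (x - b + s) \<le> G (x + b + s)" using b by (auto simp: G_def)
    then show ?thesis using False b by (auto simp: indicator_def)
  qed
  have "2 * b\<^sup>2 * rad_exp bs (\<lambda>s. ?W (x - b + s))
      \<le> b * (rad_exp bs (\<lambda>s. G (x + b + s)) - rad_exp bs (\<lambda>s. G (x - b + s)))"
    unfolding rad_exp_cmult[symmetric] rad_exp_diff[symmetric] using pointwise by (intro rad_exp_mono)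
  moreover have "rad_exp (b # bs) (\<lambda>s. G (x + s) * s)
     = (rad_exp bs (\<lambda>s. G (x + b + s) * s) + b * rad_exp bs (\<lambda>s. G (x + b + s))
        + (rad_exp bs (\<lambda>s. G (x - b + s) * s) - b * rad_exp bs (\<lambda>s. G (x - b + s)))) / 2"
  proof -
    have "(\<lambda>s. G (x + (s + b)) * (s + b)) = (\<lambda>s. G (x + b + s) * s + b * G (x + b + s))"
      "(\<lambda>s. G (x + (s - b)) * (s - b)) = (\<lambda>s. G (x - b + s) * s - b * G (x - b + s))"
      by (simp_all add: algebra_simps)
    then show ?thesis by (simp add: rad_exp_add rad_exp_diff rad_exp_cmult)
  qed
  moreover have "rad_exp (map (\<lambda>b. (b, b\<^sup>2)) (b # bs)) (\<lambda>p. ?W (x + fst p) * ((\<Sum>b\<leftarrow>b # bs. b\<^sup>2) - snd p))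
     = (rad_exp ?ps (\<lambda>p. ?W (x + b + fst p) * (?T - snd p))
       + (rad_exp ?ps (\<lambda>p. ?W (x - b + fst p) * (?T - snd p)) + 2 * b\<^sup>2 * rad_exp ?ps (\<lambda>p. ?W (x - b + fst p)))) / 2"
  proof -
    have "(\<lambda>p. ?W (x + fst (p + (b, b\<^sup>2))) * (b\<^sup>2 + ?T - snd (p + (b, b\<^sup>2))))
        = (\<lambda>p. ?W (x + b + fst p) * (?T - snd p))"
      "(\<lambda>p. ?W (x + fst (p - (b, b\<^sup>2))) * (b\<^sup>2 + ?T - snd (p - (b, b\<^sup>2))))
        = (\<lambda>p. ?W (x - b + fst p) * (?T - snd p) + 2 * b\<^sup>2 * ?W (x - b + fst p))"
      by (simp_all add: algebra_simps)
    then show ?thesis by (simp add: rad_exp_add rad_exp_cmult del: fst_add snd_add fst_diff snd_diff)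
  qed
  ultimately show ?case using IH[of "x + b"] IH[of "x - b"] unfolding W by argo
qed simp

text \<open>Write \<open>z = snd p\<close> for \<open>\<Sum>j. b\<^sub>j\<^sup>2 x\<^sub>j\<close>. Unless \<open>z\<close> exceeds 3/4, the factor \<open>1 - z\<close> in the
preceding bound is at least 1/4, so the window has probability at most four times the ramp moment, which the
level-1 inequality controls because the ramp is at most \<open>4 * a\<close> times the indicator of
\<open>{t<..}\<close>. The variance of \<open>z\<close> is at most \<open>a\<^sup>2\<close>, so its exceptional event costs
\<open>exp (- 9 / (32 * a\<^sup>2))\<close>, which is of order \<open>a * m\<close> once \<open>a * sqrt (ln (1 / m))\<close> is
at most 3/8. For larger values the trivial bound \<open>m\<close> suffices.\<close>

lemma rad_prob_window_le:
  fixes as :: "real list" and t a :: real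
  defines "m \<equiv> rad_prob as {t<..}"
  assumes norm: "(\<Sum>b\<leftarrow>as. b\<^sup>2) = 1" and as: "\<And>b. b \<in> set as \<Longrightarrow> 0 \<le> b \<and> b \<le> a"
    and "0 < a" "0 \<le> t" "0 < m" "m \<le> 1 / 2"
  shows "rad_prob as {t<..t + 2 * a} \<le> 26 * (m * min 1 (a * sqrt (ln (1 / m))))"
proof -
  define L where "L = ln (1 / m)"
  define W where "W = {t<..t + 2 * a}"
  have "exp (2 / 3) \<le> (2::real)"
    using ln2_ge_two_thirds ln_ge_iff[of 2 "2 / 3"] by simp
  also have "2 \<le> 1 / m" using \<open>0 < m\<close> \<open>m \<le> 1/2\<close> by (simp add: field_simps)
  finally have L: "2 / 3 \<le> L" unfolding L_def using \<open>0 < m\<close> ln_ge_iff[of "1 / m" "2 / 3"] by simp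
  have sL: "4 / 5 \<le> sqrt L" using L by (intro real_le_rsqrt) (simp add: power2_eq_square)
  have expL: "exp (- L) = m" using \<open>0 < m\<close> by (simp add: L_def ln_div)
  show ?thesis
  proof (cases "3 / 8 < a * sqrt L")
    case True
    have "rad_prob as W \<le> m" unfolding m_def W_def by (intro rad_prob_mono) auto
    also have "m \<le> 26 * (m * min 1 (a * sqrt L))" using True \<open>0 < m\<close> by (simp add: min_def)
    finally show ?thesis by (simp add: W_def L_def)
  next
    case False
    then have small: "a * sqrt L \<le> 3 / 8" by simp
    define ps where "ps = map (\<lambda>b. (b, b\<^sup>2)) as"
    \<comment> \<open>The minimizer of \<open>l\<^sup>2 * a\<^sup>2 / 2 - 3 / 4 * l\<close>; the minimum is \<open>- 2 * y\<close>.\<close>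
    define l where "l = 3 / (4 * a\<^sup>2)"
    define y where "y = 9 / (64 * a\<^sup>2)"
    have "(a * sqrt L)\<^sup>2 \<le> (3 / 8)\<^sup>2" using small \<open>0 < a\<close> by (intro power_mono) (auto simp: L_def intro!: mult_nonneg_nonneg real_sqrt_ge_zero order_trans[OF _ L[unfolded L_def]])
    then have a2L: "a\<^sup>2 * L \<le> 9 / 64" using L by (simp add: power_mult_distrib) (simp add: power2_eq_square)
    have "a\<^sup>2 * (2 / 3) \<le> a\<^sup>2 * L" using L by (intro mult_left_mono) auto
    then have "a\<^sup>2 \<le> 3 / 8" using a2L by simp
    then have l: "2 \<le> l" using \<open>0 < a\<close> by (simp add: l_def field_simps)
    have Ly: "L \<le> y" using a2L \<open>0 < a\<close> by (simp add: y_def field_simps)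
    define G where "G = (\<lambda>s. min (4 * a) (max 0 (s - t)))"
    have fst: "rad_exp ps (\<lambda>p. F (fst p)) = rad_exp as F" for F
      using rad_exp_map[of fst ps F] by (simp add: ps_def comp_def)
    have snd: "rad_exp ps (\<lambda>p. F (snd p)) = rad_exp (map (\<lambda>b. b\<^sup>2) as) F" for F
      using rad_exp_map[of snd ps F] by (simp add: ps_def comp_def)
    have "rad_prob as W = rad_exp ps (\<lambda>p. indicat_real W (fst p))" by (simp add: fst)
    \<comment> \<open>The exponential dominates \<open>4 * z - 3\<close> for every real \<open>z\<close>, including values above 1.\<close>
    also have "\<dots> \<le> rad_exp ps (\<lambda>p. 4 * (indicat_real W (fst p) * (1 - snd p)) + exp (- (3 / 4 * l)) * exp (l * snd p))"
    proof (rule rad_exp_mono)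
      fix p :: "real \<times> real"
      define z where "z = l * (snd p - 3 / 4)"
      have e: "exp (- (3 / 4 * l)) * exp (l * snd p) = exp z" by (simp add: exp_add[symmetric] z_def algebra_simps)
      show "indicat_real W (fst p) \<le> 4 * (indicat_real W (fst p) * (1 - snd p)) + exp (- (3 / 4 * l)) * exp (l * snd p)"
      proof (cases "fst p \<in> W")
        case True
        have "4 * snd p - 3 \<le> exp z"
        proof (cases "snd p \<le> 3 / 4")
          case False
          then have "2 * (snd p - 3 / 4) \<le> z" unfolding z_def using l by (intro mult_right_mono) auto
          moreover have "0 \<le> z" using False l by (simp add: z_def)
          then have "1 + z + z\<^sup>2 / 2 \<le> exp z" by (rule exp_lower_Taylor_quadratic)
          moreover have "0 \<le> (z - 1)\<^sup>2" by simp
          ultimately show ?thesis by (simp add: power2_eq_square algebra_simps)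
        qed (use exp_gt_zero[of z] in linarith)
        then show ?thesis unfolding e using True by simp
      qed simp
    qed
    also have "\<dots> = 4 * rad_exp ps (\<lambda>p. indicat_real W (fst p) * (1 - snd p))
        + exp (- (3 / 4 * l)) * rad_exp (map (\<lambda>b. b\<^sup>2) as) (\<lambda>s. exp (l * s))"
      by (simp add: rad_exp_add rad_exp_cmult snd[of "\<lambda>s. exp (l * s)"])
    also have "rad_exp ps (\<lambda>p. indicat_real W (fst p) * (1 - snd p)) \<le> 4 * a * (m * (3 / 2 * sqrt L))"
    proof -
      have "rad_exp ps (\<lambda>p. indicat_real W (fst p) * (1 - snd p)) \<le> rad_exp as (\<lambda>s. G s * s)"
        using ramp_moment_ge[of as a t 0] as by (simp add: ps_def W_def G_def norm)
      also have "\<dots> \<le> rad_exp as (\<lambda>s. 4 * a * (indicat_real {t<..} s * s))"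
        using \<open>0 < a\<close> \<open>0 \<le> t\<close> by (intro rad_exp_mono) (auto simp: G_def indicator_def intro!: mult_right_mono)
      also have "\<dots> = 4 * a * rad_exp as (\<lambda>s. indicat_real {t<..} s * s)" by (rule rad_exp_cmult)
      also have "\<dots> \<le> 4 * a * (m * sqrt (2 * L))"
        using first_moment_above_le[of as t] norm \<open>0 < m\<close> \<open>m \<le> 1/2\<close> \<open>0 < a\<close>
        by (intro mult_left_mono) (auto simp: m_def L_def)
      also have "sqrt (2 * L) \<le> 3 / 2 * sqrt L"
      proof -
        have "sqrt 2 \<le> (3 / 2::real)" by (rule real_le_lsqrt) (auto simp: power2_eq_square)
        then show ?thesis unfolding real_sqrt_mult using L by (intro mult_right_mono) auto
      qed
      finally show ?thesis using \<open>0 < a\<close> \<open>0 < m\<close> by simp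
    qed
    also have "exp (- (3 / 4 * l)) * rad_exp (map (\<lambda>b. b\<^sup>2) as) (\<lambda>s. exp (l * s)) \<le> 4 / 3 * a * m"
    proof -
      have "(\<Sum>b\<leftarrow>map (\<lambda>b. b\<^sup>2) as. b\<^sup>2) \<le> (\<Sum>b\<leftarrow>as. a\<^sup>2 * b\<^sup>2)"
        unfolding list.map_comp comp_def
      proof (rule sum_list_mono)
        fix b assume "b \<in> set as"
        then have "b\<^sup>2 \<le> a\<^sup>2" using as[of b] by (intro power_mono) auto
        then show "(b\<^sup>2)\<^sup>2 \<le> a\<^sup>2 * b\<^sup>2" unfolding power2_eq_square[of "b\<^sup>2"] by (intro mult_right_mono) auto
      qed
      also have "\<dots> = a\<^sup>2" by (simp add: sum_list_const_mult norm)
      finally have T: "(\<Sum>b\<leftarrow>map (\<lambda>b. b\<^sup>2) as. b\<^sup>2) \<le> a\<^sup>2" .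
      have "rad_exp (map (\<lambda>b. b\<^sup>2) as) (\<lambda>s. exp (l * s)) \<le> exp (l\<^sup>2 * (\<Sum>b\<leftarrow>map (\<lambda>b. b\<^sup>2) as. b\<^sup>2) / 2)"
        by (rule rad_exp_exp_le)
      also have "\<dots> \<le> exp (l\<^sup>2 * a\<^sup>2 / 2)" using T by (simp add: mult_left_mono)
      finally have "exp (- (3 / 4 * l)) * rad_exp (map (\<lambda>b. b\<^sup>2) as) (\<lambda>s. exp (l * s))
          \<le> exp (- (3 / 4 * l)) * exp (l\<^sup>2 * a\<^sup>2 / 2)" by simp
      also have "\<dots> = exp (- (3 / 4 * l) + l\<^sup>2 * a\<^sup>2 / 2)" by (simp add: exp_add[symmetric])
      also have "- (3 / 4 * l) + l\<^sup>2 * a\<^sup>2 / 2 = - y + - y"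
        using \<open>0 < a\<close> by (simp add: l_def y_def field_simps power2_eq_square)
      also have "exp (- y + - y) = exp (- y) * exp (- y)" by (rule exp_add)
      also have "\<dots> \<le> 4 / 3 * a * m"
      proof (rule mult_mono)
        show "exp (- y) \<le> m" using Ly expL by (metis exp_le_cancel_iff neg_le_iff_le)
        have "0 \<le> (3 / (8 * a) - 1)\<^sup>2" by simp
        moreover have "y = (3 / (8 * a))\<^sup>2" by (simp add: y_def power2_eq_square)
        ultimately have "3 / (4 * a) \<le> 1 + y" by (simp add: power2_eq_square algebra_simps)
        also have "\<dots> \<le> exp y" by (rule exp_ge_add_one_self)
        finally show "exp (- y) \<le> 4 / 3 * a" using \<open>0 < a\<close> by (simp add: exp_minus field_simps)
      qed (use \<open>0 < a\<close> in auto)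
      finally show ?thesis .
    qed
    also have "4 / 3 * a * m \<le> a * m * (5 / 3 * sqrt L)"
      using sL mult_left_mono[of "4 / 3" "5 / 3 * sqrt L" "a * m"] \<open>0 < a\<close> \<open>0 < m\<close>
      by (simp add: mult_ac)
    finally have "rad_prob as W \<le> (24 + 5 / 3) * (m * (a * sqrt L))" by (simp add: algebra_simps)
    also have "\<dots> \<le> 26 * (m * (a * sqrt L))"
      using \<open>0 < a\<close> \<open>0 < m\<close> L by (intro mult_right_mono mult_nonneg_nonneg) auto
    also have "a * sqrt L = min 1 (a * sqrt L)" using small by simp
    finally show ?thesis by (simp add: W_def L_def)
  qed
qed

section \<open>The lower bound\<close>

text \<open>Let \<open>d\<close> be the step of the local Chernoff bound that leaves at most a quarter of the tail beyond
\<open>t + d\<close>. If \<open>d \<le> 2 * a\<close>, the coordinate of weight \<open>a\<close> alone can undo a shift of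
this size and its influence is at least \<open>m\<close>. Otherwise \<open>{t<..t + d}\<close> carries at least
\<open>3 / 4 * m\<close> and is covered by at most \<open>d / a\<close> intervals of length \<open>2 * a\<close>,
each of which has at most 82 times the mass of the window at \<open>t\<close>.\<close>

lemma window_ge:
  fixes ys :: "real list" and t a :: real
  defines "m \<equiv> rad_prob (a # ys) {t<..}"
  assumes norm: "(\<Sum>b\<leftarrow>a # ys. b\<^sup>2) = 1"
    and sorted: "sorted_wrt (\<ge>) ys" and ys: "\<And>y. y \<in> set ys \<Longrightarrow> 0 \<le> y \<and> y \<le> a"
    and a: "0 < a" and t: "0 \<le> t" and m: "0 < m" "m < 1"
  shows "m * min 1 (a * sqrt (ln (1 / m))) \<le> 656 * window ys a t"
proof -
  define L where "L = ln (1 / m)"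
  define d where "d = sqrt (32 / L)"
  let ?w = "window ys a t"
  have L: "0 < L" using m by (auto simp: L_def)
  have d: "0 < d" "d\<^sup>2 = 32 / L" using L by (auto simp: d_def)
  have P: "rad_prob (a # ys) {c<..} = (rad_prob ys {c - a<..} + rad_prob ys {c + a<..}) / 2" for c
  proof -
    have "(\<lambda>s. indicat_real {c<..} (s + a)) = indicat_real {c - a<..}"
      "(\<lambda>s. indicat_real {c<..} (s - a)) = indicat_real {c + a<..}"
      by (auto simp: indicator_def)
    then show ?thesis by simp
  qed
  have "rad_prob (a # ys) {t + d<..} * L \<le> 8 * m / d\<^sup>2"
    unfolding m_def L_def by (rule local_Chernoff) (use norm ys a d m in \<open>auto simp: m_def\<close>)
  then have tail: "rad_prob (a # ys) {t + d<..} \<le> m / 4" using L by (simp add: d)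
  show ?thesis
  proof (cases "d \<le> 2 * a")
    case True
    have "rad_prob (a # ys) {t + 2 * a<..} \<le> rad_prob (a # ys) {t + d<..}"
      using True by (intro rad_prob_mono) auto
    moreover have "rad_prob ys {t + a<..} \<le> 2 * rad_prob (a # ys) {t + 2 * a<..}"
      using rad_prob_nonneg[of ys "{t + 2 * a + a<..}"] by (subst P) (simp add: algebra_simps)
    moreover have "rad_prob ys {t - a<..} = ?w + rad_prob ys {t + a<..}"
      unfolding window_def using a by (intro rad_prob_split) auto
    ultimately have "m \<le> ?w" using tail P[of t] unfolding m_def by argo
    moreover have "m * min 1 (a * sqrt L) \<le> m * 1" using m by (intro mult_left_mono) auto
    ultimately show ?thesis unfolding L_def using m by linarith
  next
    case False
    \<comment> \<open>The number of intervals of length \<open>2 * a\<close> needed to cover \<open>{t<..t + d}\<close>.\<close>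
    define K where "K = nat \<lceil>d / (2 * a)\<rceil>"
    let ?J = "\<lambda>j. {t + 2 * a * real j<..t + 2 * a * real j + 2 * a}"
    have win: "rad_prob (a # ys) (?J j) \<le> 82 * ?w" for j
    proof -
      define s where "s = t + 2 * a * real j"
      have "(\<lambda>r. indicat_real {s<..s + 2 * a} (r + a)) = indicat_real {s - a<..s + a}"
        "(\<lambda>r. indicat_real {s<..s + 2 * a} (r - a)) = indicat_real {s + 2 * a - a<..s + 2 * a + a}"
        by (auto simp: indicator_def fun_eq_iff)
      then have "rad_prob (a # ys) {s<..s + 2 * a} = (window ys a s + window ys a (s + 2 * a)) / 2"
        by (simp add: window_def)
      moreover have "window ys a s \<le> 82 * ?w" "window ys a (s + 2 * a) \<le> 82 * ?w"
        by (rule window_le_window[OF sorted ys a t]; use a in \<open>simp add: s_def\<close>)+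
      ultimately show ?thesis by (simp add: s_def)
    qed
    have "m \<le> rad_prob (a # ys) ({t<..t + d} \<union> {t + d<..})"
      unfolding m_def by (intro rad_prob_mono) auto
    also have "\<dots> \<le> rad_prob (a # ys) {t<..t + d} + rad_prob (a # ys) {t + d<..}"
      by (rule rad_prob_union_le)
    finally have "3 / 4 * m \<le> rad_prob (a # ys) {t<..t + d}" using tail by linarith
    also have "\<dots> \<le> rad_exp (a # ys) (\<lambda>s. \<Sum>j<K. indicat_real (?J j) s)"
    proof (rule rad_exp_mono)
      fix s
      show "indicat_real {t<..t + d} s \<le> (\<Sum>j<K. indicat_real (?J j) s)"
      proof (cases "s \<in> {t<..t + d}")
        case True
        define j where "j = nat (\<lceil>(s - t) / (2 * a)\<rceil> - 1)"
        have pos: "0 < (s - t) / (2 * a)" using True a by simp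
        then have "0 < \<lceil>(s - t) / (2 * a)\<rceil>" by simp
        then have j: "int j = \<lceil>(s - t) / (2 * a)\<rceil> - 1" by (simp add: j_def)
        then have "real j = of_int \<lceil>(s - t) / (2 * a)\<rceil> - 1" by linarith
        then have "real j < (s - t) / (2 * a)" "(s - t) / (2 * a) \<le> real j + 1" by linarith+
        then have "s \<in> ?J j" using a by (simp add: field_simps)
        moreover have "\<lceil>(s - t) / (2 * a)\<rceil> \<le> \<lceil>d / (2 * a)\<rceil>"
          using True a by (intro ceiling_mono divide_right_mono) auto
        then have "j < K" using j unfolding K_def by linarith
        ultimately have "indicat_real (?J j) s \<le> (\<Sum>j<K. indicat_real (?J j) s)"
          by (intro member_le_sum) auto
        then show ?thesis using \<open>s \<in> ?J j\<close> True by simp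
      qed (simp add: sum_nonneg)
    qed
    also have "\<dots> \<le> (\<Sum>j<K. 82 * ?w)"
      unfolding rad_exp_sum by (intro sum_mono win)
    also have "\<dots> = real K * (82 * ?w)" by simp
    also have "\<dots> \<le> d / a * (82 * ?w)"
    proof (rule mult_right_mono)
      have "0 \<le> d / (2 * a)" using d a by simp
      then have "real K \<le> d / (2 * a) + 1" unfolding K_def by linarith
      also have "\<dots> \<le> d / a" using False a by (simp add: field_simps)
      finally show "real K \<le> d / a" .
    qed (simp add: window_def rad_prob_nonneg)
    also have "\<dots> \<le> 6 / sqrt L / a * (82 * ?w)"
    proof (intro mult_right_mono divide_right_mono)
      have "sqrt 32 \<le> (6::real)" by (rule real_le_lsqrt) auto
      then show "d \<le> 6 / sqrt L" using L by (simp add: d_def real_sqrt_divide divide_right_mono)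
    qed (use a in \<open>simp_all add: window_def rad_prob_nonneg\<close>)
    finally have "m * (a * sqrt L) \<le> 656 * ?w" using a L by (simp add: field_simps)
    moreover have "m * min 1 (a * sqrt L) \<le> m * (a * sqrt L)" using m by (intro mult_left_mono) auto
    ultimately show ?thesis unfolding L_def by linarith
  qed
qed

text \<open>By symmetry a nonnegative sum has probability at least 1/2. A tail of at most 1/2 at a negative threshold
therefore leaves no mass in \<open>{t<..0}\<close>, and the threshold may be replaced by 0.\<close>

lemma negative_threshold:
  fixes ys :: "real list" and t a :: real
  assumes "t < 0" "0 < a" "rad_prob (a # ys) {t<..} \<le> 1 / 2"
  shows "rad_prob (a # ys) {t<..0} = 0" "window ys a t = window ys a 0"
proof -
  let ?P = "rad_prob (a # ys)"
  have "?P {..<0} = ?P {0<..}"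
  proof -
    have "indicat_real {..<0::real} = (\<lambda>s. indicat_real {0<..} (- s))" by (auto simp: indicator_def)
    then show ?thesis by (simp only: rad_exp_uminus)
  qed
  moreover have "?P UNIV = ?P {..<0} + ?P {0..}" "?P {0..} = ?P {0} + ?P {0<..}"
    by (rule rad_prob_split; force)+
  moreover have "?P UNIV = 1"
  proof -
    have "indicat_real UNIV = (\<lambda>_::real. 1)" by auto
    then show ?thesis by (simp only: rad_exp_const)
  qed
  moreover have "?P {t<..} = ?P {t<..0} + ?P {0<..}"
    using assms by (intro rad_prob_split) auto
  moreover have "?P {0} \<le> ?P {t<..0}" using assms by (intro rad_prob_mono) auto
  ultimately show zero: "?P {t<..0} = 0"
    using assms(3) rad_prob_nonneg[of "a # ys" "{t<..0}"] by linarith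
  have "(\<lambda>s. indicat_real {t<..0} (s + a)) = indicat_real {t - a<..- a}"
    "(\<lambda>s. indicat_real {t<..0} (s - a)) = indicat_real {t + a<..a}"
    by (auto simp: indicator_def fun_eq_iff)
  then have "rad_prob ys {t - a<..- a} + rad_prob ys {t + a<..a} = 0"
    using zero by simp
  then have z: "rad_prob ys {t - a<..- a} = 0" "rad_prob ys {t + a<..a} = 0"
    using rad_prob_nonneg[of ys "{t - a<..- a}"] rad_prob_nonneg[of ys "{t + a<..a}"] by linarith+
  have "window ys a t + rad_prob ys {t + a<..a} = rad_prob ys {t - a<..a}"
    unfolding window_def using assms
    by (intro rad_prob_split[symmetric]) auto
  moreover have "rad_prob ys {t - a<..- a} + window ys a 0 = rad_prob ys {t - a<..a}"
    unfolding window_def using assms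
    by (intro rad_prob_split[symmetric]) auto
  ultimately show "window ys a t = window ys a 0" using z by simp
qed

section \<open>Influences on the cube\<close>

lemma card_cube: "card (cube n) = 2 ^ n"
  by (simp add: cube_def card_PiE numeral_2_eq_2)

lemma expectation_cube:
  fixes f :: "(nat \<Rightarrow> real) \<Rightarrow> real"
  shows "measure_pmf.expectation (cube_pmf n) f = (\<Sum>x\<in>cube n. f x) / 2 ^ n"
  by (simp add: cube_pmf_def integral_pmf_of_set[OF cube_nonempty finite_cube] card_cube)

lemma sum_cube_Suc:
  fixes f :: "(nat \<Rightarrow> real) \<Rightarrow> real"
  shows "(\<Sum>x\<in>cube (Suc n). f x) = (\<Sum>x\<in>cube n. f (x(Suc n := 1)) + f (x(Suc n := - 1)))"
proof -
  have inj: "inj_on (\<lambda>(y, g). g(Suc n := y)) ({-1, 1} \<times> cube n)"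
    unfolding cube_def
  proof (rule inj_onI, clarify)
    fix y g y' g' assume g: "g \<in> {1..n} \<rightarrow>\<^sub>E {-1, 1::real}" "g' \<in> {1..n} \<rightarrow>\<^sub>E {-1, 1::real}"
      and eq: "g(Suc n := y) = g'(Suc n := (y'::real))"
    have "g (Suc n) = g' (Suc n)" using g by (auto simp: PiE_def extensional_def)
    then show "y = y' \<and> g = g'" using eq by (metis fun_upd_same fun_upd_triv fun_upd_upd)
  qed
  have "cube (Suc n) = (\<lambda>(y, g). g(Suc n := y)) ` ({-1, 1} \<times> cube n)"
    by (simp add: cube_def atLeastAtMostSuc_conv PiE_insert_eq)
  then have "(\<Sum>x\<in>cube (Suc n). f x) = (\<Sum>(y, g)\<in>{-1, 1} \<times> cube n. f (g(Suc n := y)))"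
    by (simp only: sum.reindex[OF inj]) (simp add: case_prod_unfold comp_def)
  also have "\<dots> = (\<Sum>y\<in>{-1, 1}. \<Sum>g\<in>cube n. f (g(Suc n := y)))"
    by (rule sum.cartesian_product[symmetric])
  also have "\<dots> = (\<Sum>x\<in>cube n. f (x(Suc n := 1)) + f (x(Suc n := - 1)))"
    by (simp add: sum.distrib add.commute)
  finally show ?thesis .
qed

lemma expectation_linear_form:
  "measure_pmf.expectation (cube_pmf n) (\<lambda>x. F (\<Sum>i=1..n. a i * x i)) = rad_exp (map a [1..<Suc n]) F"
  unfolding expectation_cube
proof (induction n arbitrary: F)
  case 0
  then show ?case by (simp add: cube_def)
next
  case (Suc n)
  have "(\<Sum>i=1..n. a i * (x(Suc n := y)) i) = (\<Sum>i=1..n. a i * x i)" for x y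
    by (intro sum.cong) auto
  then have "(\<Sum>x\<in>cube (Suc n). F (\<Sum>i=1..Suc n. a i * x i)) / 2 ^ Suc n
     = (\<Sum>x\<in>cube n. (F ((\<Sum>i=1..n. a i * x i) + a (Suc n)) + F ((\<Sum>i=1..n. a i * x i) - a (Suc n))) / 2) / 2 ^ n"
    by (simp add: sum_cube_Suc sum_divide_distrib[symmetric])
  also have "\<dots> = rad_exp (map a [1..<Suc n]) (\<lambda>s. (F (s + a (Suc n)) + F (s - a (Suc n))) / 2)"
    by (rule Suc.IH)
  also have "\<dots> = rad_exp (map a [1..<Suc (Suc n)]) F"
    by (simp add: rad_exp_append)
  finally show ?case .
qed

lemma influence_eq_sum: "influence n f i = (\<Sum>x\<in>cube n. of_bool (f x \<noteq> f (flip x i))) / 2 ^ n"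
proof -
  have "influence n f i = measure_pmf.expectation (cube_pmf n) (indicat_real {x. f x \<noteq> f (flip x i)})"
    by (simp add: influence_def)
  also have "\<dots> = (\<Sum>x\<in>cube n. indicat_real {x. f x \<noteq> f (flip x i)} x) / 2 ^ n"
    by (rule expectation_cube)
  finally show ?thesis by (simp add: indicator_def)
qed

lemma flip_in_cube: "x \<in> cube n \<Longrightarrow> i \<in> {1..n} \<Longrightarrow> flip x i \<in> cube n"
  by (auto simp: cube_def flip_def PiE_def Pi_def extensional_def)

lemma flip_flip: "flip (flip x i) i = x"
  by (simp add: flip_def)

lemma linear_form_split:
  fixes a x :: "nat \<Rightarrow> real"
  assumes "i \<in> {1..n}"
  shows "(\<Sum>j=1..n. a j * x j) = (\<Sum>j=1..n. (a(i := 0)) j * x j) + a i * x i"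
proof -
  have "(\<Sum>j\<in>{1..n} - {i}. (a(i := 0)) j * x j) = (\<Sum>j\<in>{1..n} - {i}. a j * x j)"
    by (intro sum.cong) auto
  then show ?thesis
    unfolding sum.remove[OF finite_atLeastAtMost assms] by simp
qed

lemma linear_form_flip:
  fixes a x :: "nat \<Rightarrow> real"
  assumes "i \<in> {1..n}"
  shows "(\<Sum>j=1..n. a j * flip x i j) = (\<Sum>j=1..n. (a(i := 0)) j * x j) - a i * x i"
proof -
  have "(\<Sum>j=1..n. (a(i := 0)) j * flip x i j) = (\<Sum>j=1..n. (a(i := 0)) j * x j)"
    by (intro sum.cong) (auto simp: flip_def)
  then show ?thesis using linear_form_split[OF assms, of a "flip x i"] by (simp add: flip_def)
qed

text \<open>Where flipping a sign changes the halfspace, exactly one of the two points lies above the threshold, by at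
most \<open>2 * a i\<close>. Flipping preserves the uniform measure, whence the factor 2.\<close>

lemma influence_halfspace_le:
  assumes i: "i \<in> {1..n}" and "0 \<le> a i" "a i \<le> b"
  shows "influence n (halfspace n a t) i \<le> 2 * rad_prob (map a [1..<Suc n]) {t<..t + 2 * b}"
proof -
  let ?X = "\<lambda>x. \<Sum>j=1..n. a j * x j" and ?W = "indicat_real {t<..t + 2 * b}"
  have "(\<Sum>x\<in>cube n. of_bool (halfspace n a t x \<noteq> halfspace n a t (flip x i)))
      \<le> (\<Sum>x\<in>cube n. ?W (?X x) + ?W (?X (flip x i)))"
  proof (rule sum_mono)
    fix x assume "x \<in> cube n"
    then have "x i \<in> {-1, 1}" using i by (auto simp: cube_def PiE_def Pi_def)
    then have "\<bar>?X x - ?X (flip x i)\<bar> \<le> 2 * b"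
      using linear_form_split[OF i, of a x] linear_form_flip[OF i, of a x] assms(2,3) by auto
    then show "of_bool (halfspace n a t x \<noteq> halfspace n a t (flip x i)) \<le> ?W (?X x) + ?W (?X (flip x i))"
      by (auto simp: halfspace_def indicator_def)
  qed
  also have "\<dots> = 2 * (\<Sum>x\<in>cube n. ?W (?X x))"
  proof -
    have "(\<Sum>x\<in>cube n. ?W (?X (flip x i))) = (\<Sum>x\<in>cube n. ?W (?X x))"
      by (rule sum.reindex_bij_witness[where i = "\<lambda>x. flip x i" and j = "\<lambda>x. flip x i"])
        (use i in \<open>auto simp: flip_flip flip_in_cube\<close>)
    then show ?thesis by (simp add: sum.distrib)
  qed
  finally have "influence n (halfspace n a t) i \<le> 2 * ((\<Sum>x\<in>cube n. ?W (?X x)) / 2 ^ n)"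
    by (simp add: influence_eq_sum divide_right_mono)
  also have "\<dots> = 2 * rad_prob (map a [1..<Suc n]) {t<..t + 2 * b}"
    using expectation_linear_form[of n ?W a] by (simp add: expectation_cube)
  finally show ?thesis .
qed

text \<open>The weight of the first coordinate is set to 0 so that the sum of the others is again a linear form
on the full cube.\<close>

lemma influence_halfspace_first:
  assumes "1 \<le> n" "0 \<le> a 1"
  shows "influence n (halfspace n a t) 1 = window (map a [2..<Suc n]) (a 1) t"
proof -
  let ?Y = "\<lambda>x. \<Sum>j=1..n. (a(1 := 0)) j * x j"
  have one: "1 \<in> {1..n}" using assms by simp
  have "influence n (halfspace n a t) 1 = (\<Sum>x\<in>cube n. indicat_real {t - a 1<..t + a 1} (?Y x)) / 2 ^ n"
    unfolding influence_eq_sum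
  proof (intro arg_cong2[where f = "(/)"] sum.cong refl)
    fix x assume "x \<in> cube n"
    then have "x 1 = 1 \<or> x 1 = -1" using one by (auto simp: cube_def PiE_def Pi_def)
    then show "of_bool (halfspace n a t x \<noteq> halfspace n a t (flip x 1)) = indicat_real {t - a 1<..t + a 1} (?Y x)"
      unfolding halfspace_def linear_form_split[OF one, of a x] linear_form_flip[OF one, of a x]
      using assms(2) by (auto simp: indicator_def)
  qed
  also have "\<dots> = rad_prob (map (a(1 := 0)) [1..<Suc n]) {t - a 1<..t + a 1}"
    using expectation_linear_form[of n _ "a(1 := 0)"] by (simp add: expectation_cube)
  also have "[1..<Suc n] = 1 # [2..<Suc n]" using assms by (simp add: upt_rec numeral_2_eq_2)
  also have "map (a(1 := 0)) (1 # [2..<Suc n]) = 0 # map a [2..<Suc n]" by simp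
  finally show ?thesis by (simp add: window_def)
qed

theorem theorem1p4:
  shows "\<exists>c1 c2 :: real. c1 > 0 \<and> c2 > 0 \<and>
    (\<forall>(n::nat) (t::real) (a :: nat \<Rightarrow> real).
      n \<ge> 1 \<longrightarrow>
      (\<forall>i\<in>{1..n}. \<forall>j\<in>{1..n}. i \<le> j \<longrightarrow> a i \<ge> a j) \<longrightarrow>
      a n \<ge> 0 \<longrightarrow>
      (\<Sum>i=1..n. (a i)\<^sup>2) = 1 \<longrightarrow>
      (let f = halfspace n a t;
           m = measure_pmf.expectation (cube_pmf n) f;
           I = Max (influence n f ` {1..n})
       in m \<le> 1 / 2 \<longrightarrow>
          c1 * influence_bound m (a 1) \<le> I \<and> I \<le> c2 * influence_bound m (a 1)))"
proof -
  have "1 / 656 * influence_bound m (a 1) \<le> I \<and> I \<le> 52 * influence_bound m (a 1)"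
    if n: "n \<ge> 1" and mono: "\<forall>i\<in>{1..n}. \<forall>j\<in>{1..n}. i \<le> j \<longrightarrow> a i \<ge> a j"
      and an: "a n \<ge> 0" and norm: "(\<Sum>i=1..n. (a i)\<^sup>2) = 1"
      and m_def: "m = measure_pmf.expectation (cube_pmf n) (halfspace n a t)"
      and I_def: "I = Max (influence n (halfspace n a t) ` {1..n})" and half: "m \<le> 1 / 2"
    for n t and a :: "nat \<Rightarrow> real" and m I
  proof -
    define ys where "ys = map a [2..<Suc n]"
    let ?as = "a 1 # ys"
    have as: "map a [1..<Suc n] = ?as" using n by (simp add: ys_def upt_rec numeral_2_eq_2)
    have coeff: "0 \<le> a i \<and> a i \<le> a 1" if "i \<in> {1..n}" for i
    proof -
      have "a n \<le> a i" "a i \<le> a 1" using mono n that by auto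
      then show ?thesis using an by auto
    qed
    have ys: "0 \<le> y \<and> y \<le> a 1" if "y \<in> set ys" for y
      using that coeff by (auto simp: ys_def)
    have sorted: "sorted_wrt (\<ge>) ys"
      unfolding ys_def sorted_wrt_map
      by (rule sorted_wrt_mono_rel[OF _ sorted_wrt_upt]) (use mono in auto)
    have norm': "(\<Sum>b\<leftarrow>?as. b\<^sup>2) = 1"
    proof -
      have "(\<Sum>b\<leftarrow>map a [1..<Suc n]. b\<^sup>2) = (\<Sum>i=1..n. (a i)\<^sup>2)"
        unfolding list.map_comp comp_def by (simp only: interv_sum_list_conv_sum_set_nat set_upt atLeastLessThanSuc_atLeastAtMost)
      then show ?thesis unfolding as norm .
    qed
    have a1: "0 < a 1"
    proof (rule ccontr)
      assume "\<not> 0 < a 1"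
      then have "a i = 0" if "i \<in> {1..n}" for i using coeff[OF that] by simp
      then show False using norm by simp
    qed
    have m: "m = rad_prob ?as {t<..}"
      using expectation_linear_form[of n "indicat_real {t<..}" a] as
      by (simp add: m_def halfspace_def[abs_def] indicator_def of_bool_def)
    have lower: "window ys (a 1) t \<le> I"
    proof -
      have "influence n (halfspace n a t) 1 = window ys (a 1) t"
        unfolding ys_def by (rule influence_halfspace_first) (use n a1 in auto)
      moreover have "influence n (halfspace n a t) 1 \<le> I"
        unfolding I_def using n by (intro Max_ge) auto
      ultimately show ?thesis by simp
    qed
    have upper: "I \<le> 2 * rad_prob ?as {t<..t + 2 * a 1}"
      unfolding I_def using n influence_halfspace_le[of _ n a "a 1" t] coeff as by (subst Max_le_iff) auto
    show ?thesis
    proof (cases "m = 0")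
      case True
      have "rad_prob ?as {t<..t + 2 * a 1} \<le> m" unfolding m by (intro rad_prob_mono) auto
      moreover have "0 \<le> window ys (a 1) t" by (simp add: window_def rad_prob_nonneg)
      ultimately show ?thesis using True lower upper by (simp add: influence_bound_def)
    next
      case False
      \<comment> \<open>Negative thresholds are moved to 0, where the estimates for nonnegative thresholds apply.\<close>
      define t' where "t' = max t 0"
      have m0: "0 < m" using False rad_prob_nonneg[of ?as "{t<..}"] m by simp
      have "rad_prob ?as {t<..} = rad_prob ?as {t'<..} \<and> window ys (a 1) t = window ys (a 1) t'
        \<and> rad_prob ?as {t<..t + 2 * a 1} \<le> rad_prob ?as {t'<..t' + 2 * a 1}"
      proof (cases "t < 0")
        case True
        have neg: "rad_prob ?as {t<..0} = 0" "window ys (a 1) t = window ys (a 1) 0"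
          using negative_threshold[OF True a1, of ys] half m by auto
        have "rad_prob ?as {t<..} = rad_prob ?as {t<..0} + rad_prob ?as {0<..}"
          using True by (intro rad_prob_split) auto
        moreover have "rad_prob ?as {t<..t + 2 * a 1} \<le> rad_prob ?as ({t<..0} \<union> {0<..2 * a 1})"
          using True by (intro rad_prob_mono) auto
        then have "rad_prob ?as {t<..t + 2 * a 1} \<le> rad_prob ?as {t<..0} + rad_prob ?as {0<..2 * a 1}"
          using rad_prob_union_le order_trans by blast
        ultimately show ?thesis using neg True by (simp add: t'_def del: rad_exp.simps)
      qed (simp add: t'_def)
      then have *: "m = rad_prob ?as {t'<..}" "window ys (a 1) t' \<le> I"
        "I \<le> 2 * rad_prob ?as {t'<..t' + 2 * a 1}"
        using m lower upper by auto
      have t': "0 \<le> t'" by (simp add: t'_def)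
      have "m * min 1 (a 1 * sqrt (ln (1 / m))) \<le> 656 * window ys (a 1) t'"
        unfolding *(1) by (rule window_ge) (use norm' sorted ys a1 t' m0 half *(1) in auto)
      moreover have "rad_prob ?as {t'<..t' + 2 * a 1} \<le> 26 * (m * min 1 (a 1 * sqrt (ln (1 / m))))"
        unfolding *(1) by (rule rad_prob_window_le) (use norm' ys a1 t' m0 half *(1) in auto)
      ultimately show ?thesis using *(2,3) False by (simp add: influence_bound_def)
    qed
  qed
  then show ?thesis
    by (intro exI[of _ "1 / 656"] exI[of _ 52]) (simp add: Let_def)
qed

end
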